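(* Let $\mathfrak{f}\in\mathbb{Z}_p[T]$ be a random $p$-adic polynomial of degree $d$, $x\in\mathbb{Z}_p$ and $s\ge1$ an integer. Then for every $\ell\in\mathbb{N}$, $$\mathbb{P}(\mathrm{St}(\mathfrak{f};x,p^{-s})\ge\ell)\le\frac43p^{-s\binom{\ell+1}{2}}.$$ Moreover, for $k\ge1$, $$\mathbb{E}\,\mathrm{St}(\mathfrak{f};x,p^{-s})^k\le2p^{-s}\left(1+\left(\frac{k}{s\ln p}\right)^{k/2}\right).$$
   Context: A random $p$-adic polynomial of degree $d$ is $\mathfrak{f}=\sum_{k=0}^d\mathfrak{f}_kT^k$ with the $\mathfrak{f}_k$ independent and Haar-uniformly distributed in $\mathbb{Z}_p$. For nonzero $f=\sum_kf_kT^k\in\mathbb{Q}_p[T]$, $\mathrm{St}(f):=\max\{k\in\mathbb{N}:|f_l|\le|f_k|\text{ for all }l<k\}$ (with $f_k=0$ for $k>\deg f$), where $|\cdot|$ is the $p$-adic absolute value, and $\mathrm{St}(f;x,p^{-s}):=\mathrm{St}(f(x+p^sT))$. *)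

theory Defs
  imports
    "HOL-Probability.Probability"
    "HOL-Computational_Algebra.Computational_Algebra"
    "Berlekamp_Zassenhaus.Finite_Field"
begin

section \<open>The ring of \<open>p\<close>-adic integers\<close>

text \<open>
  The prime is \<open>p = CARD('p)\<close> for a type \<open>'p\<close> of class \<^class>\<open>prime_card\<close>. The \<open>p\<close>-adic integers
  are the inverse limit of the rings of integers modulo \<open>p ^ n\<close>: the \<open>n\<close>-th entry is the residue
  modulo \<open>p ^ n\<close>, represented in \<open>{0..<p ^ n}\<close>.
\<close>

typedef ('p :: prime_card) padic_int =
  "{x :: nat \<Rightarrow> int. \<forall>n. 0 \<le> x n \<and> x n < int CARD('p) ^ n \<and> x (Suc n) mod int CARD('p) ^ n = x n}"
  morphisms residue Abs_padic_int
  by (rule exI[of _ "\<lambda>_. 0"]) (auto simp: prime_gt_0_nat[OF prime_card])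

setup_lifting type_definition_padic_int

lemma card_gt_1: "1 < int CARD('p :: prime_card)"
  using prime_gt_1_nat[of "CARD('p)"] prime_card by auto

lemma card_power_pos [simp]: "0 < int CARD('p :: prime_card) ^ n"
  using card_gt_1[where 'p = 'p] by simp

lemma mod_card_power_Suc: "a mod int CARD('p) ^ Suc n mod int CARD('p) ^ n = a mod int CARD('p) ^ n"
  by (rule mod_mod_cancel) simp

lemma padic_int_eqI:
  fixes x y :: "'p :: prime_card padic_int"
  assumes "\<And>n. residue x n = residue y n"
  shows "x = y"
  using assms by (metis ext residue_inject)

lemma residue_bounds:
  fixes x :: "'p :: prime_card padic_int"
  shows "0 \<le> residue x n" "residue x n < int CARD('p) ^ n"
  using residue[of x] by auto

lemma residue_mod_self:
  fixes x :: "'p :: prime_card padic_int"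
  shows "residue x n mod int CARD('p) ^ n = residue x n"
  using residue_bounds[of x n] by simp

lemma residue_Suc_mod:
  fixes x :: "'p :: prime_card padic_int"
  shows "residue x (Suc n) mod int CARD('p) ^ n = residue x n"
  using residue[of x] by auto

lemma residue_mod:
  fixes x :: "'p :: prime_card padic_int"
  assumes "m \<le> n"
  shows "residue x n mod int CARD('p) ^ m = residue x m"
  using assms
proof (induction n rule: dec_induct)
  case base
  show ?case by (rule residue_mod_self)
next
  case (step n)
  have "residue x (Suc n) mod int CARD('p) ^ m =
      residue x (Suc n) mod int CARD('p) ^ n mod int CARD('p) ^ m"
    by (rule mod_mod_cancel[symmetric]) (use step in \<open>simp add: le_imp_power_dvd\<close>)
  with step show ?case by (simp add: residue_Suc_mod)
qed

instantiation padic_int :: (prime_card) comm_ring_1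
begin

lift_definition zero_padic_int :: "'a padic_int" is "\<lambda>_. 0"
  by simp

lift_definition one_padic_int :: "'a padic_int" is "\<lambda>n. 1 mod int CARD('a) ^ n"
  by (auto simp: mod_card_power_Suc simp del: power_Suc)

lift_definition plus_padic_int :: "'a padic_int \<Rightarrow> 'a padic_int \<Rightarrow> 'a padic_int"
  is "\<lambda>x y n. (x n + y n) mod int CARD('a) ^ n"
  by (auto simp: mod_card_power_Suc simp del: power_Suc, metis mod_add_eq)

lift_definition minus_padic_int :: "'a padic_int \<Rightarrow> 'a padic_int \<Rightarrow> 'a padic_int"
  is "\<lambda>x y n. (x n - y n) mod int CARD('a) ^ n"
  by (auto simp: mod_card_power_Suc simp del: power_Suc, metis mod_diff_eq)

lift_definition uminus_padic_int :: "'a padic_int \<Rightarrow> 'a padic_int"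
  is "\<lambda>x n. (- x n) mod int CARD('a) ^ n"
  by (auto simp: mod_card_power_Suc simp del: power_Suc, metis mod_minus_eq)

lift_definition times_padic_int :: "'a padic_int \<Rightarrow> 'a padic_int \<Rightarrow> 'a padic_int"
  is "\<lambda>x y n. (x n * y n) mod int CARD('a) ^ n"
  by (auto simp: mod_card_power_Suc simp del: power_Suc, metis mod_mult_eq)

instance
proof
  fix a b c :: "'a padic_int"
  note rs = zero_padic_int.rep_eq one_padic_int.rep_eq plus_padic_int.rep_eq
    minus_padic_int.rep_eq uminus_padic_int.rep_eq times_padic_int.rep_eq
  show "a * b * c = a * (b * c)"
    by (rule padic_int_eqI) (simp add: rs mod_simps ac_simps)
  show "a * b = b * a"
    by (rule padic_int_eqI) (simp add: rs ac_simps)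
  show "1 * a = a"
    by (rule padic_int_eqI) (simp add: rs mod_simps residue_mod_self)
  show "a + b + c = a + (b + c)"
    by (rule padic_int_eqI) (simp add: rs mod_simps ac_simps)
  show "a + b = b + a"
    by (rule padic_int_eqI) (simp add: rs ac_simps)
  show "0 + a = a"
    by (rule padic_int_eqI) (simp add: rs residue_mod_self)
  show "- a + a = 0"
    by (rule padic_int_eqI) (simp add: rs mod_simps)
  show "a - b = a + - b"
    by (rule padic_int_eqI) (simp add: rs mod_simps)
  show "(a + b) * c = a * c + b * c"
    by (rule padic_int_eqI) (simp add: rs mod_simps distrib_right)
  have "residue (0 :: 'a padic_int) 1 \<noteq> residue 1 1"
    using card_gt_1[where 'p = 'a] by (simp add: rs)
  then show "(0 :: 'a padic_int) \<noteq> 1"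
    by metis
qed

end

text \<open>
  The valuation of a nonzero \<open>x\<close> is the largest \<open>n\<close> such that \<open>p ^ n\<close> divides \<open>x\<close>, that is, such
  that the residue of \<open>x\<close> modulo \<open>p ^ n\<close> vanishes. The value at \<open>0\<close> is irrelevant.
\<close>

definition padic_int_val :: "'p :: prime_card padic_int \<Rightarrow> nat" where
  "padic_int_val x = (LEAST n. residue x (Suc n) \<noteq> 0)"

definition padic_int_abs :: "'p :: prime_card padic_int \<Rightarrow> real" where
  "padic_int_abs x = (if x = 0 then 0 else real CARD('p) powi (- int (padic_int_val x)))"

lemma residue_0_right [simp]: "residue x 0 = 0"
  using residue_bounds[of x 0] by simp

lemma residue_Suc_val:
  assumes "x \<noteq> 0"
  shows "residue x (Suc (padic_int_val x)) \<noteq> 0"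
proof -
  obtain n where n: "residue x n \<noteq> 0"
    using assms padic_int_eqI[of x 0] by (auto simp: zero_padic_int.rep_eq)
  then obtain m where "n = Suc m"
    by (cases n) auto
  with n show ?thesis
    unfolding padic_int_val_def by (metis (mono_tags, lifting) LeastI)
qed

lemma residue_eq_0_iff:
  assumes "x \<noteq> 0"
  shows "residue x n = 0 \<longleftrightarrow> n \<le> padic_int_val x"
proof
  assume "residue x n = 0"
  then show "n \<le> padic_int_val x"
    using residue_Suc_val[OF assms] residue_mod[of "Suc (padic_int_val x)" n x]
    by (metis mod_0 not_less_eq_eq)
next
  assume *: "n \<le> padic_int_val x"
  show "residue x n = 0"
  proof (cases n)
    case (Suc m)
    with * have "m < (LEAST n. residue x (Suc n) \<noteq> 0)"
      by (simp add: padic_int_val_def)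
    from not_less_Least[OF this] Suc show ?thesis by simp
  qed simp
qed

lemma card_power_dvd_residue_iff:
  fixes x :: "'p :: prime_card padic_int"
  assumes "m \<le> n"
  shows "int CARD('p) ^ m dvd residue x n \<longleftrightarrow> residue x m = 0"
  using residue_mod[OF assms, of x] by (simp add: dvd_eq_mod_eq_0)

lemma residue_eq_card_power_times:
  fixes x :: "'p :: prime_card padic_int"
  assumes "x \<noteq> 0" "padic_int_val x < n"
  obtains a where "residue x n = int CARD('p) ^ padic_int_val x * a" "\<not> int CARD('p) dvd a"
proof -
  have "int CARD('p) ^ padic_int_val x dvd residue x n"
    using assms by (simp add: card_power_dvd_residue_iff residue_eq_0_iff)
  then obtain a where a: "residue x n = int CARD('p) ^ padic_int_val x * a"
    by blast
  have "\<not> int CARD('p) ^ Suc (padic_int_val x) dvd residue x n"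
    using assms by (subst card_power_dvd_residue_iff) (auto simp: residue_Suc_val)
  then have "\<not> int CARD('p) dvd a"
    unfolding a using mult_dvd_mono by fastforce
  with a that show ?thesis by blast
qed

lemma padic_int_mult_aux:
  fixes x y :: "'p :: prime_card padic_int"
  assumes "x \<noteq> 0" "y \<noteq> 0"
  shows "x * y \<noteq> 0 \<and> padic_int_val (x * y) = padic_int_val x + padic_int_val y"
proof -
  define p v w where defs: "p = int CARD('p)" "v = padic_int_val x" "w = padic_int_val y"
  obtain a where a: "residue x (Suc (v + w)) = p ^ v * a" "\<not> p dvd a"
    using residue_eq_card_power_times[OF assms(1), of "Suc (v + w)"] unfolding defs by auto
  obtain b where b: "residue y (Suc (v + w)) = p ^ w * b" "\<not> p dvd b"
    using residue_eq_card_power_times[OF assms(2), of "Suc (v + w)"] unfolding defs by auto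
  have p: "prime p"
    unfolding defs by (rule prime_card_int)
  then have nz: "p ^ (v + w) \<noteq> 0"
    by auto
  have eq: "residue (x * y) (Suc (v + w)) = (p ^ (v + w) * (a * b)) mod p ^ Suc (v + w)"
    by (simp only: times_padic_int.rep_eq a b flip: defs) (simp add: power_add ac_simps)
  have "\<not> p dvd a * b"
    using p a b by (simp add: prime_dvd_mult_iff)
  then have "\<not> p ^ Suc (v + w) dvd p ^ (v + w) * (a * b)"
    using nz by (simp only: power_Suc2 dvd_mult_cancel_left) simp
  then have 1: "residue (x * y) (Suc (v + w)) \<noteq> 0"
    unfolding eq by (simp add: dvd_eq_mod_eq_0)
  then have ne: "x * y \<noteq> 0"
    by (auto simp: zero_padic_int.rep_eq)
  have "p ^ (v + w) dvd residue (x * y) (Suc (v + w))"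
    unfolding eq by (simp add: dvd_mod_iff le_imp_power_dvd dvd_mod)
  then have "residue (x * y) (v + w) = 0"
    unfolding defs by (subst (asm) card_power_dvd_residue_iff) auto
  with 1 ne show ?thesis
    unfolding residue_eq_0_iff[OF ne] defs by auto
qed

instance padic_int :: (prime_card) idom
  by standard (use padic_int_mult_aux in blast)

lemma padic_int_abs_mult: "padic_int_abs (x * y) = padic_int_abs x * padic_int_abs y"
  for x y :: "'p :: prime_card padic_int"
proof (cases "x = 0 \<or> y = 0")
  case False
  then show ?thesis
    using padic_int_mult_aux[of x y] card_gt_1[where 'p = 'p]
    by (simp add: padic_int_abs_def power_int_diff power_int_minus power_add divide_inverse)
qed (auto simp: padic_int_abs_def)

lemma padic_int_abs_eq_0_iff [simp]: "padic_int_abs x = 0 \<longleftrightarrow> x = 0"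
  for x :: "'p :: prime_card padic_int"
  using card_gt_1[where 'p = 'p] by (simp add: padic_int_abs_def)

lemma padic_int_abs_nonneg [simp]: "0 \<le> padic_int_abs x"
  by (simp add: padic_int_abs_def)

lemma padic_int_abs_minus: "padic_int_abs (- x) = padic_int_abs x"
  for x :: "'p :: prime_card padic_int"
proof -
  have "residue (- x) n = 0 \<longleftrightarrow> residue x n = 0" for n
    using residue_mod_self[of x n]
    by (metis dvd_eq_mod_eq_0 dvd_minus_iff uminus_padic_int.rep_eq)
  then show ?thesis
    by (simp add: padic_int_abs_def padic_int_val_def)
qed

lemma padic_int_abs_minus_le_max:
  fixes x y z :: "'p :: prime_card padic_int"
  shows "padic_int_abs (x - z) \<le> max (padic_int_abs (x - y)) (padic_int_abs (y - z))"
proof (cases "x = z")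
  case False
  define n where "n = padic_int_val (x - z)"
  have *: "padic_int_abs (x - z) \<le> padic_int_abs u" if "residue u (Suc n) \<noteq> 0" for u :: "'p padic_int"
  proof -
    from that have "u \<noteq> 0"
      by (auto simp: zero_padic_int.rep_eq)
    moreover from this that have "padic_int_val u \<le> n"
      by (simp add: residue_eq_0_iff)
    ultimately show ?thesis
      using False card_gt_1[where 'p = 'p]
      by (simp add: padic_int_abs_def n_def power_int_minus le_imp_inverse_le power_increasing)
  qed
  have "residue ((x - y) + (y - z)) (Suc n) \<noteq> 0"
    using residue_Suc_val[of "x - z"] False by (simp add: n_def)
  then have "residue (x - y) (Suc n) \<noteq> 0 \<or> residue (y - z) (Suc n) \<noteq> 0"
    unfolding plus_padic_int.rep_eq by auto
  with * show ?thesis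
    by (auto simp: le_max_iff_disj)
qed (simp add: le_max_iff_disj padic_int_abs_def[of 0])

instantiation padic_int :: (prime_card) metric_space
begin

definition dist_padic_int :: "'a padic_int \<Rightarrow> 'a padic_int \<Rightarrow> real" where
  "dist_padic_int x y = padic_int_abs (x - y)"

definition uniformity_padic_int :: "('a padic_int \<times> 'a padic_int) filter" where
  "uniformity_padic_int = (INF e\<in>{0<..}. principal {(x, y). dist x y < e})"

definition open_padic_int :: "'a padic_int set \<Rightarrow> bool" where
  "open_padic_int U \<longleftrightarrow> (\<forall>x\<in>U. \<forall>\<^sub>F (x', y) in uniformity. x' = x \<longrightarrow> y \<in> U)"

instance
proof
  fix x y z :: "'a padic_int"
  show "dist x y = 0 \<longleftrightarrow> x = y"
    by (simp add: dist_padic_int_def)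
  have 1: "padic_int_abs (z - y) = padic_int_abs (y - z)"
    using padic_int_abs_minus[of "y - z"] by simp
  have "padic_int_abs (x - y) \<le> max (padic_int_abs (x - z)) (padic_int_abs (y - z))"
    using padic_int_abs_minus_le_max[of x y z] by (simp only: 1)
  also have "\<dots> \<le> padic_int_abs (x - z) + padic_int_abs (y - z)"
    by simp
  finally show "dist x y \<le> dist x z + dist y z"
    by (simp add: dist_padic_int_def)
qed (simp_all add: uniformity_padic_int_def open_padic_int_def)

end

section \<open>The field of \<open>p\<close>-adic numbers\<close>

type_synonym 'p padic = "'p padic_int fract"

text \<open>\<open>|a / b| = |a| / |b|\<close>, independently of the representing fraction.\<close>

definition padic_abs :: "'p :: prime_card padic \<Rightarrow> real" where
  "padic_abs z = (case rep_fract z of (a, b) \<Rightarrow> padic_int_abs a / padic_int_abs b)"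

lemma padic_abs_Fract:
  fixes a b :: "'p :: prime_card padic_int"
  assumes "b \<noteq> 0"
  shows "padic_abs (Fract a b) = padic_int_abs a / padic_int_abs b"
proof -
  obtain c d where cd: "rep_fract (Fract a b) = (c, d)"
    by (cases "rep_fract (Fract a b)")
  have "fractrel (c, d) (c, d)"
    using Quotient3_rep_reflp[OF Quotient3_fract, of "Fract a b"] unfolding cd .
  then have d: "d \<noteq> 0"
    by simp
  have "Fract c d = abs_fract (c, d)"
    using d by (simp add: Fract.abs_eq)
  also have "\<dots> = Fract a b"
    using Quotient3_abs_rep[OF Quotient3_fract, of "Fract a b"] unfolding cd .
  finally have "c * b = a * d"
    using assms d by (simp add: eq_fract)
  then have "padic_int_abs c * padic_int_abs b = padic_int_abs a * padic_int_abs d"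
    by (simp flip: padic_int_abs_mult)
  with assms d show ?thesis
    by (simp add: padic_abs_def cd field_simps)
qed

lemma padic_abs_to_fract: "padic_abs (to_fract a) = padic_int_abs a"
  for a :: "'p :: prime_card padic_int"
  using padic_int_abs_mult[of 1 "1 :: 'p padic_int"] padic_int_abs_eq_0_iff[of "1 :: 'p padic_int"]
  by (simp add: to_fract_def padic_abs_Fract)

section \<open>Strassman numbers\<close>

text \<open>For \<open>f \<noteq> 0\<close> the set is finite and contains \<open>0\<close>; the value at \<open>f = 0\<close> is irrelevant.\<close>

definition strassman :: "'p :: prime_card padic poly \<Rightarrow> nat" where
  "strassman f = Max {k. \<forall>l<k. padic_abs (poly.coeff f l) \<le> padic_abs (poly.coeff f k)}"

text \<open>
  The third argument is the exponent \<open>s\<close> of the radius \<open>p\<^sup>-\<^sup>s\<close>: this is the Strassman number of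
  \<open>f(x + p\<^sup>s T)\<close>.
\<close>

definition strassman_at :: "'p :: prime_card padic poly \<Rightarrow> 'p padic \<Rightarrow> nat \<Rightarrow> nat" where
  "strassman_at f x s = strassman (pcompose f [:x, of_nat CARD('p) ^ s:])"

section \<open>Random \<open>p\<close>-adic polynomials\<close>

definition haar_probability :: "'p :: prime_card padic_int measure \<Rightarrow> bool" where
  "haar_probability \<mu> \<longleftrightarrow> sets \<mu> = sets borel \<and> emeasure \<mu> UNIV = 1 \<and>
     (\<forall>a. \<forall>A\<in>sets borel. emeasure \<mu> ((\<lambda>x. a + x) ` A) = emeasure \<mu> A)"

text \<open>As usual, ``degree \<open>d\<close>'' is a formal degree: the leading coefficient may vanish.\<close>

definition random_padic_poly ::
    "'w measure \<Rightarrow> nat \<Rightarrow> ('w \<Rightarrow> 'p :: prime_card padic_int poly) \<Rightarrow> bool" where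
  "random_padic_poly M d F \<longleftrightarrow> prob_space M \<and>
     (\<forall>\<omega>\<in>space M. degree (F \<omega>) \<le> d) \<and>
     prob_space.indep_vars M (\<lambda>_. borel) (\<lambda>k \<omega>. poly.coeff (F \<omega>) k) {..d} \<and>
     (\<forall>k\<le>d. haar_probability (distr M borel (\<lambda>\<omega>. poly.coeff (F \<omega>) k)))"

end

theory Submission
  imports Defs
begin

text \<open>
  Write \<open>f(x + p\<^sup>s T) = \<Sum> p\<^sup>s\<^sup>k h\<^sub>k T\<^sup>k\<close> with \<open>f(x + T) = \<Sum> h\<^sub>k T\<^sup>k\<close>. The substitution
  \<open>T \<mapsto> x + T\<close> permutes the polynomials of degree at most \<open>d\<close> modulo any power of \<open>p\<close>, so the
  \<open>h\<^sub>k\<close> are again independent and uniform. If the Strassman number is \<open>k\<close>, then \<open>h\<^sub>j\<close> is divisible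
  by \<open>p\<close> to the power \<open>s (k - j)\<close> for every \<open>j < k\<close>, an event of probability \<open>q\<close> to the power
  \<open>- (k + 1 choose 2)\<close>, where \<open>q = p\<^sup>s\<close>. Summing over \<open>k \<ge> l\<close> against a geometric series of
  ratio \<open>1 / 4\<close> gives the tail bound. For the moments, with \<open>L = ln q\<close>, the maximum of
  \<open>l powr k * exp (- L l\<^sup>2 / 4)\<close> over \<open>l > 0\<close> is at most \<open>(k / L) powr (k / 2)\<close>, and for \<open>l \<ge> 2\<close>
  what remains of \<open>q\<close> to the power \<open>- (l + 1 choose 2)\<close> is at most \<open>q\<close> to the power \<open>- l\<close>.
\<close>

section \<open>Residues of \<open>p\<close>-adic integers and polynomials\<close>

lemma residue_of_nat: "residue (of_nat a :: 'p :: prime_card padic_int) n = int a mod int CARD('p) ^ n"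
  by (induction a)
    (simp_all add: zero_padic_int.rep_eq plus_padic_int.rep_eq one_padic_int.rep_eq mod_simps)

lemma residue_of_int: "residue (of_int a :: 'p :: prime_card padic_int) n = a mod int CARD('p) ^ n"
proof (cases a)
  case (nonneg m)
  then show ?thesis by (simp add: residue_of_nat)
next
  case (neg m)
  have "residue (of_int a :: 'p padic_int) n = residue (- of_nat (Suc m) :: 'p padic_int) n"
    by (simp add: neg)
  also have "\<dots> = a mod int CARD('p) ^ n"
    unfolding uminus_padic_int.rep_eq residue_of_nat by (simp add: neg mod_simps)
  finally show ?thesis .
qed

lemma residue_diff_eq_0_iff:
  fixes a b :: "'p :: prime_card padic_int"
  shows "residue (a - b) n = 0 \<longleftrightarrow> residue a n = residue b n"
proof -
  have "(residue a n - residue b n) mod int CARD('p) ^ n = 0 \<longleftrightarrow>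
      residue a n mod int CARD('p) ^ n = residue b n mod int CARD('p) ^ n"
    by (simp add: mod_eq_dvd_iff dvd_eq_mod_eq_0)
  then show ?thesis
    by (simp add: minus_padic_int.rep_eq residue_mod_self)
qed

lemma residue_mult_eq_0: "residue a n = 0 \<Longrightarrow> residue (b * a) n = 0"
  by (simp add: times_padic_int.rep_eq)

lemma residue_add_eq_0: "residue a n = 0 \<Longrightarrow> residue b n = 0 \<Longrightarrow> residue (a + b) n = 0"
  by (simp add: plus_padic_int.rep_eq)

lemma residue_sum_eq_0: "(\<And>i. i \<in> I \<Longrightarrow> residue (f i) n = 0) \<Longrightarrow> residue (sum f I) n = 0"
  by (induction I rule: infinite_finite_induct)
    (simp_all add: zero_padic_int.rep_eq residue_add_eq_0)

text \<open>The elements divisible by p^n form an ideal, so the Horner recursion f = a + T g keeps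
  every coefficient of the composition in that ideal.\<close>

lemma residue_coeff_pcompose_eq_0:
  assumes "\<And>i. residue (poly.coeff f i) n = 0"
  shows "residue (poly.coeff (pcompose f q) i) n = 0"
  using assms
proof (induction f arbitrary: i)
  case 0
  then show ?case by (simp add: zero_padic_int.rep_eq)
next
  case (pCons a f)
  have "residue a n = 0" "residue (poly.coeff f i) n = 0" for i
    using pCons.prems[of 0] pCons.prems[of "Suc i"] by simp_all
  then have "residue (poly.coeff [:a:] i) n = 0" "residue (poly.coeff (q * pcompose f q) i) n = 0"
    unfolding coeff_mult
    by (auto simp: coeff_pCons zero_padic_int.rep_eq split: nat.split
        intro!: residue_sum_eq_0 residue_mult_eq_0 pCons.IH)
  then show ?case
    by (simp add: pcompose_pCons residue_add_eq_0)
qed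

text \<open>Substitution is additive in the outer polynomial, so the case of zero residues applies
  to \<open>f - g\<close>. Composition is thereby well defined modulo p^n.\<close>

lemma residue_coeff_pcompose_cong:
  assumes "\<And>i. residue (poly.coeff f i) n = residue (poly.coeff g i) n"
  shows "residue (poly.coeff (pcompose f q) i) n = residue (poly.coeff (pcompose g q) i) n"
  using residue_coeff_pcompose_eq_0[of "f - g" n q i] assms
  by (simp add: pcompose_diff residue_diff_eq_0_iff)

lemma residue_eq_0_iff_le_abs:
  fixes z :: "'p :: prime_card padic_int"
  shows "residue z n = 0 \<longleftrightarrow> padic_int_abs z \<le> inverse (real CARD('p) ^ n)"
proof (cases "z = 0")
  case False
  then show ?thesis
    using card_gt_1[where 'p = 'p]
    by (simp add: residue_eq_0_iff padic_int_abs_def power_int_minus)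
qed (simp add: zero_padic_int.rep_eq padic_int_abs_def)

text \<open>In terms of divisibility: every power of p that divides \<open>z\<close> divides
  \<open>y\<close>. For \<open>z \<noteq> 0\<close> the single exponent
  \<open>padic_int_val z\<close> decides; for \<open>z = 0\<close> all residues of \<open>y\<close>
  vanish. This form turns comparisons of absolute values into countably many conditions on
  residues.\<close>

lemma padic_int_abs_le_iff:
  fixes y z :: "'p :: prime_card padic_int"
  shows "padic_int_abs y \<le> padic_int_abs z \<longleftrightarrow> (\<forall>n. residue z n = 0 \<longrightarrow> residue y n = 0)"
proof
  assume *: "\<forall>n. residue z n = 0 \<longrightarrow> residue y n = 0"
  show "padic_int_abs y \<le> padic_int_abs z"
  proof (cases "z = 0")
    case True
    with * have "y = 0"
      by (intro padic_int_eqI) (simp add: zero_padic_int.rep_eq)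
    with True show ?thesis by (simp add: padic_int_abs_def)
  next
    case False
    then have "residue y (padic_int_val z) = 0"
      using * by (simp add: residue_eq_0_iff)
    then have "padic_int_abs y \<le> inverse (real CARD('p) ^ padic_int_val z)"
      by (simp only: residue_eq_0_iff_le_abs)
    with False show ?thesis
      by (simp add: padic_int_abs_def[of z] power_int_minus)
  qed
qed (auto simp: residue_eq_0_iff_le_abs)

section \<open>Haar measure of residue classes\<close>

lemma open_residue_vimage: "open {z :: 'p :: prime_card padic_int. residue z n = a}"
proof -
  have "residue y n = residue z n" if "dist y z < inverse (real CARD('p) ^ n)" for y z :: "'p padic_int"
    using that by (simp add: dist_padic_int_def flip: residue_diff_eq_0_iff)
      (simp add: residue_eq_0_iff_le_abs)
  moreover have "0 < inverse (real CARD('p) ^ n)"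
    using card_gt_1[where 'p = 'p] by simp
  ultimately show ?thesis
    unfolding open_dist by blast
qed

lemma measurable_residue [measurable]:
  "(\<lambda>z :: 'p :: prime_card padic_int. residue z n) \<in> measurable borel (count_space UNIV)"
  by (auto simp: measurable_count_space_eq2_countable vimage_def intro!: borel_open open_residue_vimage)

text \<open>The p^n residue classes are disjoint, cover the space and are translates of the class of
  0 by integers. Invariance gives them equal measure, and the total is 1.\<close>

lemma haar_probability_residue:
  fixes \<mu> :: "'p :: prime_card padic_int measure"
  assumes "haar_probability \<mu>" "a \<in> {0..<int CARD('p) ^ n}"
  shows "measure \<mu> {z. residue z n = a} = 1 / real CARD('p) ^ n"
proof -
  define R where "R b = {z :: 'p padic_int. residue z n = b}" for b
  have sets: "sets \<mu> = sets borel" and 1: "emeasure \<mu> UNIV = 1"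
    and inv: "\<And>a A. A \<in> sets borel \<Longrightarrow> emeasure \<mu> ((\<lambda>x. a + x) ` A) = emeasure \<mu> A"
    using assms(1) by (auto simp: haar_probability_def)
  have space: "space \<mu> = UNIV"
    using sets_eq_imp_space_eq[OF sets] by simp
  interpret prob_space \<mu>
    by standard (simp add: space 1)
  have R: "R b \<in> sets borel" for b
    by (simp add: R_def borel_open open_residue_vimage)
  have shift: "(\<lambda>z. of_int b + z) ` R 0 = R b" if "b \<in> {0..<int CARD('p) ^ n}" for b
  proof -
    have "residue (z - of_int b) n = 0 \<longleftrightarrow> residue z n = b" for z :: "'p padic_int"
      using that by (simp add: residue_diff_eq_0_iff residue_of_int)
    then have *: "z - of_int b \<in> R 0 \<longleftrightarrow> z \<in> R b" for z
      by (simp add: R_def)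
    show ?thesis
    proof (intro equalityI subsetI)
      fix z assume "z \<in> R b"
      then show "z \<in> (\<lambda>z. of_int b + z) ` R 0"
        by (intro image_eqI[of _ _ "z - of_int b"]) (simp_all add: *)
    qed (auto simp flip: *)
  qed
  have eq: "measure \<mu> (R b) = measure \<mu> (R 0)" if "b \<in> {0..<int CARD('p) ^ n}" for b
    using inv[OF R, of "of_int b" 0] shift[OF that] by (simp add: measure_def)
  have "(\<Union>b\<in>{0..<int CARD('p) ^ n}. R b) = UNIV"
  proof (intro equalityI subsetI UNIV_I)
    fix z :: "'p padic_int"
    show "z \<in> (\<Union>b\<in>{0..<int CARD('p) ^ n}. R b)"
      by (rule UN_I[of "residue z n"]) (simp_all add: residue_bounds R_def)
  qed
  then have "1 = measure \<mu> (\<Union>b\<in>{0..<int CARD('p) ^ n}. R b)"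
    using prob_space by (simp only: space)
  also have "\<dots> = (\<Sum>b\<in>{0..<int CARD('p) ^ n}. measure \<mu> (R b))"
    using R by (intro finite_measure_finite_Union) (auto simp: sets R_def disjoint_family_on_def)
  also have "\<dots> = (\<Sum>b\<in>{0..<int CARD('p) ^ n}. measure \<mu> (R a))"
    by (intro sum.cong refl) (metis eq assms(2))
  also have "\<dots> = real CARD('p) ^ n * measure \<mu> (R a)"
    by simp
  finally show ?thesis
    by (simp add: R_def field_simps)
qed

section \<open>Coefficient vectors modulo p^n and the substitution T -> x + T\<close>

text \<open>Lifts a vector of residues to an actual polynomial, so that operations on polynomials
  can be transported to residue vectors.\<close>

definition poly_of :: "nat \<Rightarrow> (nat \<Rightarrow> int) \<Rightarrow> 'p :: prime_card padic_int poly" where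
  "poly_of d v = (\<Sum>i\<le>d. Polynomial.monom (of_int (v i)) i)"

lemma coeff_poly_of: "poly.coeff (poly_of d v) i = (if i \<le> d then of_int (v i) else 0)"
  by (simp add: poly_of_def coeff_sum)

lemma degree_poly_of: "degree (poly_of d v) \<le> d"
  by (rule degree_le) (simp add: coeff_poly_of)

lemma degree_pcompose_linear_le:
  fixes f :: "'a :: idom poly"
  assumes "degree f \<le> d"
  shows "degree (pcompose f [:x, c:]) \<le> d"
  using degree_pcompose_le[of f "[:x, c:]"] assms by (auto split: if_splits)

text \<open>The restriction makes the vector an element of a finite extensional product, where
  equality is equality of functions and cardinalities are available.\<close>

definition coeff_residues :: "nat \<Rightarrow> nat \<Rightarrow> 'p :: prime_card padic_int poly \<Rightarrow> nat \<Rightarrow> int" where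
  "coeff_residues d n f = restrict (\<lambda>i. residue (poly.coeff f i) n) {..d}"

lemma coeff_residues_in_PiE:
  fixes f :: "'p :: prime_card padic_int poly"
  shows "coeff_residues d n f \<in> {..d} \<rightarrow>\<^sub>E {0..<int CARD('p) ^ n}"
  unfolding coeff_residues_def by (intro restrict_PiE_iff[THEN iffD2] ballI) (simp add: residue_bounds)

lemma coeff_residues_poly_of:
  assumes "v \<in> {..d} \<rightarrow>\<^sub>E {0..<int CARD('p) ^ n}"
  shows "coeff_residues d n (poly_of d v :: 'p :: prime_card padic_int poly) = v"
proof
  fix i
  show "coeff_residues d n (poly_of d v :: 'p padic_int poly) i = v i"
  proof (cases "i \<le> d")
    case True
    then have "v i \<in> {0..<int CARD('p) ^ n}"
      using assms by (intro PiE_mem[OF assms]) simp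
    with True show ?thesis
      by (simp add: coeff_residues_def coeff_poly_of residue_of_int)
  next
    case False
    then show ?thesis
      using PiE_arb[OF assms, of i] by (simp add: coeff_residues_def)
  qed
qed

lemma coeff_residues_eq_iff:
  fixes f g :: "'p :: prime_card padic_int poly"
  assumes "degree f \<le> d" "degree g \<le> d"
  shows "coeff_residues d n f = coeff_residues d n g \<longleftrightarrow> (\<forall>i. residue (poly.coeff f i) n = residue (poly.coeff g i) n)"
proof -
  have "residue (poly.coeff f i) n = residue (poly.coeff g i) n" if "\<not> i \<le> d" for i
    using that assms by (simp add: coeff_eq_0)
  then have "(\<forall>i. residue (poly.coeff f i) n = residue (poly.coeff g i) n) \<longleftrightarrow>
      (\<forall>i\<in>{..d}. residue (poly.coeff f i) n = residue (poly.coeff g i) n)"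
    by blast
  then show ?thesis
    by (auto simp: coeff_residues_def fun_eq_iff restrict_def)
qed

lemma coeff_residues_pcompose_cong:
  fixes f g :: "'p :: prime_card padic_int poly"
  assumes "degree f \<le> d" "degree g \<le> d" "coeff_residues d n f = coeff_residues d n g"
  shows "coeff_residues d n (pcompose f q) = coeff_residues d n (pcompose g q)"
  using residue_coeff_pcompose_cong[of f n g q] assms
  by (simp add: coeff_residues_eq_iff) (simp add: coeff_residues_def)

lemma pcompose_shift_inverse:
  fixes f :: "'a :: comm_ring_1 poly"
  shows "pcompose (pcompose f [:- x, 1:]) [:x, 1:] = f"
    "pcompose (pcompose f [:x, 1:]) [:- x, 1:] = f"
  by (simp_all add: pcompose_pCons flip: pcompose_assoc)

text \<open>Coefficients of the composition modulo p^n depend on \<open>f\<close> only through its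
  residue vector, which takes finitely many values. Measurability is obtained from this
  factorisation.\<close>

lemma residue_coeff_pcompose_poly_of:
  fixes f :: "'p :: prime_card padic_int poly"
  assumes "degree f \<le> d"
  shows "residue (poly.coeff (pcompose f q) i) n =
    residue (poly.coeff (pcompose (poly_of d (coeff_residues d n f)) q) i) n"
proof (rule residue_coeff_pcompose_cong)
  have "coeff_residues d n f = coeff_residues d n (poly_of d (coeff_residues d n f) :: 'p padic_int poly)"
    by (simp add: coeff_residues_poly_of[OF coeff_residues_in_PiE])
  then show "residue (poly.coeff f i) n =
      residue (poly.coeff (poly_of d (coeff_residues d n f) :: 'p padic_int poly) i) n" for i
    by (simp add: coeff_residues_eq_iff assms degree_poly_of)
qed

text \<open>The substitution T -> x + T acts on residue vectors and is inverted by T -> -x + T. An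
  event on the shifted polynomial thus becomes an event on \<open>f\<close> itself, with another
  prescribed vector.\<close>

lemma coeff_residues_pcompose_shift_eq_iff:
  fixes f :: "'p :: prime_card padic_int poly" and x :: "'p padic_int"
  assumes "degree f \<le> d" "v \<in> {..d} \<rightarrow>\<^sub>E {0..<int CARD('p) ^ n}"
  shows "coeff_residues d n (pcompose f [:x, 1:]) = v \<longleftrightarrow>
    coeff_residues d n f = coeff_residues d n (pcompose (poly_of d v) [:- x, 1:])"
proof -
  note deg [simp] = degree_pcompose_linear_le assms(1) degree_poly_of
  have "coeff_residues d n (pcompose f [:x, 1:]) = coeff_residues d n (poly_of d v :: 'p padic_int poly) \<longleftrightarrow>
      coeff_residues d n f = coeff_residues d n (pcompose (poly_of d v) [:- x, 1:])"
    (is "?l \<longleftrightarrow> ?r")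
  proof
    assume ?l
    from coeff_residues_pcompose_cong[OF _ _ this, of "[:- x, 1:]"] show ?r
      by (simp add: pcompose_shift_inverse)
  next
    assume ?r
    from coeff_residues_pcompose_cong[OF _ _ this, of "[:x, 1:]"] show ?l
      by (simp add: pcompose_shift_inverse)
  qed
  then show ?thesis
    using coeff_residues_poly_of[OF assms(2)] by simp
qed

section \<open>Real estimates\<close>

lemma Suc_Suc_choose_2: "Suc (Suc k) choose 2 = Suc k + (Suc k choose 2)"
  by (simp add: numeral_2_eq_2)

text \<open>The exponents are k, k - 1, ..., 1, and their sum is the binomial coefficient.\<close>

lemma prod_power_diff: "(\<Prod>i<k. r ^ (k - i)) = (r :: 'a :: comm_semiring_1) ^ (Suc k choose 2)"
proof (induction k)
  case (Suc k)
  then show ?case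
    by (subst prod.lessThan_Suc_shift) (simp add: Suc_Suc_choose_2 power_add mult.assoc del: binomial_Suc_Suc)
qed (simp add: numeral_2_eq_2)

text \<open>Passing from \<open>l\<close> to \<open>l + 1\<close> multiplies the summand by
  \<open>r ^ Suc l\<close>, which is at most 1/4 because \<open>l \<ge> 1\<close>. The constant
  reproduces itself: 1 + (1/4)(4/3) = 4/3.\<close>

lemma sum_power_choose_2_le:
  fixes r :: real
  assumes "0 \<le> r" "r \<le> 1 / 2" "1 \<le> l"
  shows "(\<Sum>k=l..<l + n. r ^ (Suc k choose 2)) \<le> 4 / 3 * r ^ (Suc l choose 2)"
  using assms(3)
proof (induction n arbitrary: l)
  case 0
  then show ?case using assms by simp
next
  case (Suc n)
  have "r ^ Suc l \<le> r ^ 2"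
    using assms Suc.prems by (intro power_decreasing) auto
  also have "\<dots> \<le> (1 / 2) ^ 2"
    using assms by (intro power_mono) auto
  finally have "r ^ Suc l \<le> 1 / 4"
    by (simp add: power2_eq_square)
  then have "r ^ Suc l * r ^ (Suc l choose 2) \<le> 1 / 4 * r ^ (Suc l choose 2)"
    using assms by (intro mult_right_mono) auto
  then have "r ^ (Suc (Suc l) choose 2) \<le> 1 / 4 * r ^ (Suc l choose 2)"
    unfolding Suc_Suc_choose_2 power_add .
  moreover have "(\<Sum>k=Suc l..<Suc l + n. r ^ (Suc k choose 2)) \<le> 4 / 3 * r ^ (Suc (Suc l) choose 2)"
    by (rule Suc.IH) simp
  moreover have "(\<Sum>k=l..<l + Suc n. r ^ (Suc k choose 2)) =
      r ^ (Suc l choose 2) + (\<Sum>k=Suc l..<Suc l + n. r ^ (Suc k choose 2))"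
    by (subst sum.atLeast_Suc_lessThan) simp_all
  ultimately show ?case by linarith
qed

lemma sum_power_from_2_le:
  fixes r :: real
  assumes "0 \<le> r" "r \<le> 1 / 2"
  shows "(\<Sum>l=2..n. r ^ l) \<le> r"
proof -
  \<comment> \<open>The claim is strengthened by one more copy of the last power, which pays for two
    copies of the next one since \<open>2 * r \<le> 1\<close>.\<close>
  have "(\<Sum>l=2..Suc n. r ^ l) + r ^ Suc n \<le> r" for n
  proof (induction n)
    case (Suc n)
    have "2 * r * r ^ Suc n \<le> 1 * r ^ Suc n"
      using assms by (intro mult_right_mono) auto
    with Suc show ?case by simp
  qed simp
  from this[of "n - 1"] show ?thesis
    using assms by (cases n) (auto intro: order.trans[rotated])
qed

text \<open>After taking logarithms and substituting u = L l^2 / k, the inequality reduces to 2 ln u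
  \<le> u.\<close>

lemma powr_mult_exp_le:
  fixes k L l :: real
  assumes "0 < k" "0 < L" "0 < l"
  shows "l powr k * exp (- (L * l\<^sup>2 / 4)) \<le> (k / L) powr (k / 2)"
proof -
  define u where "u = L * l\<^sup>2 / k"
  have u: "0 < u"
    using assms by (simp add: u_def)
  \<comment> \<open>Adds ln (u/2) \<le> u/2 - 1 and ln 2 \<le> 1.\<close>
  have "2 * ln u \<le> u"
    using ln_le_minus_one[of "u / 2"] ln_le_minus_one[of 2] u by (simp add: ln_div)
  moreover have "2 * ln l = ln u + ln (k / L)"
    using assms by (simp add: u_def ln_div ln_mult ln_realpow)
  moreover have "k * u = L * l\<^sup>2"
    using assms by (simp add: u_def)
  ultimately have "k * ln l - L * l\<^sup>2 / 4 \<le> k / 2 * ln (k / L)"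
    using mult_left_mono[of "2 * ln u" u "k / 4"] assms
    by (simp add: algebra_simps)
  then have "exp (k * ln l - L * l\<^sup>2 / 4) \<le> exp (k / 2 * ln (k / L))"
    by simp
  then show ?thesis
    using assms by (simp add: powr_def flip: exp_add)
qed

text \<open>The term \<open>l = 1\<close> equals 1/q. For \<open>l \<ge> 2\<close> part of the
  exponent is spent on bounding \<open>real l powr k\<close> by \<open>A\<close>, and the remaining
  factor q^(-l) sums to at most 1/q.\<close>

lemma sum_powr_mult_power_choose_2_le:
  fixes k q :: real
  assumes "0 < k" "2 \<le> q"
  shows "(\<Sum>l=1..n. real l powr k * (1 / q) ^ (Suc l choose 2))
    \<le> 2 * (1 / q) * (1 + (k / ln q) powr (k / 2))"
proof -
  define A where "A = (k / ln q) powr (k / 2)"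
  have A: "0 \<le> A" by (simp add: A_def)
  have L: "0 < ln q" using assms by simp
  have power: "(1 / q) ^ m = exp (- (ln q * real m))" for m
    using assms by (simp add: power_one_over exp_minus exp_of_nat2_mult inverse_eq_divide)
  have summand: "real l powr k * (1 / q) ^ (Suc l choose 2) \<le> A * (1 / q) ^ l" if "2 \<le> l" for l
  proof -
    have "2 * (Suc l choose 2) = l * (l + 1)"
      by (simp add: choose_two)
    then have "2 * real (Suc l choose 2) = real l * (real l + 1)"
      by (metis of_nat_1 of_nat_add of_nat_mult of_nat_numeral)
    \<comment> \<open>This is where \<open>l \<ge> 2\<close> enters: it is equivalent to l^2/4 + l
      \<le> l(l + 1)/2.\<close>
    moreover have "2 * real l \<le> real l * real l"
      using that by (intro mult_right_mono) auto
    ultimately have "(real l)\<^sup>2 / 4 + real l \<le> real (Suc l choose 2)"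
      by (simp add: power2_eq_square algebra_simps)
    then have "ln q * ((real l)\<^sup>2 / 4 + real l) \<le> ln q * real (Suc l choose 2)"
      using L by (intro mult_left_mono) auto
    then have "(1 / q) ^ (Suc l choose 2) \<le> exp (- (ln q * (real l)\<^sup>2 / 4)) * (1 / q) ^ l"
      unfolding power by (simp add: algebra_simps flip: exp_add)
    then have "real l powr k * (1 / q) ^ (Suc l choose 2) \<le>
        (real l powr k * exp (- (ln q * (real l)\<^sup>2 / 4))) * (1 / q) ^ l"
      unfolding mult.assoc by (intro mult_left_mono) auto
    also have "\<dots> \<le> A * (1 / q) ^ l"
      unfolding A_def using assms L that
      by (intro mult_right_mono powr_mult_exp_le) auto
    finally show ?thesis .
  qed
  have "(\<Sum>l=1..n. real l powr k * (1 / q) ^ (Suc l choose 2)) \<le>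
      1 / q + (\<Sum>l=2..n. real l powr k * (1 / q) ^ (Suc l choose 2))"
    using assms by (cases "n = 0") (simp_all add: sum.atLeast_Suc_atMost numeral_2_eq_2)
  also have "\<dots> \<le> 1 / q + A * (\<Sum>l=2..n. (1 / q) ^ l)"
    unfolding sum_distrib_left by (intro add_left_mono sum_mono summand) auto
  also have "\<dots> \<le> 1 / q + A * (1 / q)"
    using assms A by (intro add_left_mono mult_left_mono sum_power_from_2_le) (auto simp: field_simps)
  also have "\<dots> \<le> 2 * (1 / q) * (1 + A)"
    using assms A by (simp add: field_simps)
  finally show ?thesis
    by (simp add: A_def)
qed

section \<open>Strassman numbers\<close>

text \<open>The embedding of the p-adic integers into their fraction field is a ring homomorphism
  preserving absolute values, so the Strassman number can be computed with integral
  coefficients.\<close>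

lemma strassman_at_fract_poly:
  fixes f :: "'p :: prime_card padic_int poly"
  shows "strassman_at (fract_poly f) (to_fract x) s =
    Max {k. \<forall>l<k. padic_int_abs (poly.coeff (pcompose f [:x, of_nat CARD('p) ^ s:]) l)
      \<le> padic_int_abs (poly.coeff (pcompose f [:x, of_nat CARD('p) ^ s:]) k)}"
proof -
  interpret to_fract: comm_ring_hom "to_fract :: 'p padic_int \<Rightarrow> 'p padic"
    by standard simp_all
  have "fract_poly [:x, of_nat CARD('p) ^ s:] = [:to_fract x, of_nat CARD('p) ^ s:]"
    by (simp add: Polynomial.map_poly_pCons to_fract.hom_power to_fract.hom_of_nat)
  then have "pcompose (fract_poly f) [:to_fract x, of_nat CARD('p) ^ s:] =
      fract_poly (pcompose f [:x, of_nat CARD('p) ^ s:])"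
    by (simp add: to_fract.map_poly_pcompose)
  then show ?thesis
    by (simp add: strassman_at_def strassman_def coeff_map_poly padic_abs_to_fract)
qed

lemma residue_card_power_times_eq_0:
  fixes z :: "'p :: prime_card padic_int"
  assumes "residue (of_nat CARD('p) ^ m * z) (m + n) = 0"
  shows "residue z n = 0"
proof -
  have "int CARD('p) ^ (m + n) dvd int CARD('p) ^ m * residue z (m + n)"
    using assms residue_of_nat[where 'p = 'p, of "CARD('p) ^ m" "m + n"]
    by (simp add: times_padic_int.rep_eq mod_simps dvd_eq_mod_eq_0)
  then have "int CARD('p) ^ n dvd residue z (m + n)"
    unfolding power_add by simp
  then show ?thesis
    by (simp add: card_power_dvd_residue_iff)
qed

lemma residue_card_power_times:
  "residue (of_nat CARD('p) ^ n * z :: 'p :: prime_card padic_int) n = 0"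
  using residue_of_nat[where 'p = 'p, of "CARD('p) ^ n" n]
  by (simp add: times_padic_int.rep_eq)

text \<open>Coefficient i of f(x + p^s T) is p^(s i) h_i, where h_i is the one of f(x + T). At the
  Strassman number k it is divisible by p^(s k); by the defining inequality so is p^(s j) h_j for j
  < k, and p^(s j) cancels.\<close>

lemma strassman_at_properties:
  fixes f :: "'p :: prime_card padic_int poly"
  assumes "f \<noteq> 0" "degree f \<le> d" "strassman_at (fract_poly f) (to_fract x) s = k"
  shows "k \<le> d" "j < k \<Longrightarrow> residue (poly.coeff (pcompose f [:x, 1:]) j) (s * (k - j)) = 0"
proof -
  define G where "G = pcompose f [:x, of_nat CARD('p) ^ s:]"
  define H where "H = pcompose f [:x, 1:]"
  define K where "K = {k. \<forall>l<k. padic_int_abs (poly.coeff G l) \<le> padic_int_abs (poly.coeff G k)}"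
  have "G = pcompose H [:0, of_nat CARD('p) ^ s:]"
    by (simp add: G_def H_def pcompose_pCons flip: pcompose_assoc)
  then have coeff_G: "poly.coeff G i = of_nat CARD('p) ^ (s * i) * poly.coeff H i" for i
    by (simp add: coeff_pcompose_linear power_mult)
  have "H \<noteq> 0"
    using assms(1) pcompose_shift_inverse(2)[of f x] by (auto simp: H_def)
  then obtain m where m: "poly.coeff H m \<noteq> 0"
    by (auto simp: poly_eq_iff)
  have "degree H \<le> d"
    unfolding H_def by (rule degree_pcompose_linear_le) fact
  then have H_0: "poly.coeff H i = 0" if "d < i" for i
    using that by (simp add: coeff_eq_0)
  \<comment> \<open>The modulus is p^2 because p vanishes modulo p.\<close>
  have "residue (of_nat CARD('p) :: 'p padic_int) 2 \<noteq> 0"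
    using card_gt_1[where 'p = 'p] by (simp add: residue_of_nat power2_eq_square)
  then have "of_nat CARD('p) \<noteq> (0 :: 'p padic_int)"
    by (auto simp: zero_padic_int.rep_eq)
  with m have "poly.coeff G m \<noteq> 0"
    by (simp add: coeff_G)
  then have abs_m: "0 < padic_int_abs (poly.coeff G m)"
    by (simp add: less_le)
  have "m \<le> d"
    using m H_0[of m] by (cases "d < m") simp_all
  \<comment> \<open>Beyond \<open>d\<close> the coefficients of \<open>G\<close> vanish and cannot
    dominate the nonzero one at \<open>m\<close>. Hence \<open>K\<close> is finite and its maximum
    is attained.\<close>
  have "k \<le> d" if "k \<in> K" for k
  proof (rule ccontr)
    assume "\<not> k \<le> d"
    then have "m < k" "poly.coeff G k = 0"
      using \<open>m \<le> d\<close> coeff_G[of k] H_0[of k] by simp_all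
    moreover from \<open>m < k\<close> that have "padic_int_abs (poly.coeff G m) \<le> padic_int_abs (poly.coeff G k)"
      unfolding K_def by blast
    ultimately show False
      using abs_m by (simp add: padic_int_abs_def[of 0])
  qed
  then have "K \<subseteq> {..d}"
    by auto
  moreover have "0 \<in> K"
    by (simp add: K_def)
  moreover have "k = Max K"
    using assms(3) by (simp add: strassman_at_fract_poly K_def G_def)
  ultimately have k: "k \<in> K" "k \<le> d"
    using Max_in[of K] finite_subset[of K "{..d}"]
    by (metis empty_iff finite_atMost, metis atMost_iff empty_iff finite_atMost subsetD)
  then show "k \<le> d" by simp
  assume j: "j < k"
  have "residue (poly.coeff G k) (s * k) = 0"
    by (simp add: coeff_G residue_card_power_times)
  with k j have "residue (poly.coeff G j) (s * k) = 0"
    unfolding K_def padic_int_abs_le_iff by blast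
  moreover have "s * k = s * j + s * (k - j)"
    using j by (simp flip: distrib_left)
  ultimately show "residue (poly.coeff (pcompose f [:x, 1:]) j) (s * (k - j)) = 0"
    unfolding coeff_G H_def by (metis residue_card_power_times_eq_0)
qed

section \<open>Random polynomials\<close>

lemma two_le_card_power:
  assumes "1 \<le> s"
  shows "2 \<le> real CARD('p :: prime_card) ^ s"
proof -
  have p: "2 \<le> real CARD('p)"
    using card_gt_1[where 'p = 'p] by linarith
  also have "real CARD('p) ^ 1 \<le> real CARD('p) ^ s"
    using assms p by (intro power_increasing) auto
  finally show ?thesis
    by simp
qed

lemma card_multiples_below:
  fixes a b :: int
  assumes "0 < a" "0 \<le> b"
  shows "card {z \<in> {0..<a * b}. a dvd z} = nat b"
proof -
  have "{z \<in> {0..<a * b}. a dvd z} = (\<lambda>z. a * z) ` {0..<b}"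
    using assms by (auto simp: zero_le_mult_iff dvd_def)
  moreover have "inj_on (\<lambda>z. a * z) {0..<b}"
    using assms by (auto simp: inj_on_def)
  ultimately show ?thesis
    by (simp add: card_image)
qed

context
  fixes M :: "'w measure" and d :: nat and F :: "'w \<Rightarrow> 'p :: prime_card padic_int poly"
  assumes random: "random_padic_poly M d F"
begin

interpretation prob_space M
  using random by (simp add: random_padic_poly_def)

lemma degree_random_poly: "\<omega> \<in> space M \<Longrightarrow> degree (F \<omega>) \<le> d"
  using random by (simp add: random_padic_poly_def)

lemma indep_coeffs: "indep_vars (\<lambda>_. borel) (\<lambda>k \<omega>. poly.coeff (F \<omega>) k) {..d}"
  using random by (simp add: random_padic_poly_def)

lemma measurable_coeff: "k \<le> d \<Longrightarrow> (\<lambda>\<omega>. poly.coeff (F \<omega>) k) \<in> borel_measurable M"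
  using indep_coeffs by (simp add: indep_vars_def)

lemma prob_residue_coeff:
  assumes "k \<le> d" "a \<in> {0..<int CARD('p) ^ n}"
  shows "prob {\<omega> \<in> space M. residue (poly.coeff (F \<omega>) k) n = a} = 1 / real CARD('p) ^ n"
proof -
  have "haar_probability (distr M borel (\<lambda>\<omega>. poly.coeff (F \<omega>) k))"
    using random assms by (simp add: random_padic_poly_def)
  from haar_probability_residue[OF this assms(2)] show ?thesis
    using assms(1)
    by (subst (asm) measure_distr)
      (auto simp: measurable_coeff borel_open open_residue_vimage vimage_def Int_def conj_commute)
qed

lemma prob_coeff_residues:
  assumes "v \<in> {..d} \<rightarrow>\<^sub>E {0..<int CARD('p) ^ n}"
  shows "{\<omega> \<in> space M. coeff_residues d n (F \<omega>) = v} \<in> events"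
    "prob {\<omega> \<in> space M. coeff_residues d n (F \<omega>) = v} = (1 / real CARD('p) ^ n) ^ Suc d"
proof -
  define X where "X k \<omega> = residue (poly.coeff (F \<omega>) k) n" for k \<omega>
  have X: "indep_vars (\<lambda>_. count_space UNIV) X {..d}"
    unfolding X_def by (rule indep_vars_compose2[OF indep_coeffs]) simp
  have v: "v k \<in> {0..<int CARD('p) ^ n}" if "k \<le> d" for k
    using that by (intro PiE_mem[OF assms]) simp
  have "coeff_residues d n f = v \<longleftrightarrow> (\<forall>k\<le>d. residue (poly.coeff f k) n = v k)"
    for f :: "'p padic_int poly"
    using PiE_arb[OF assms] by (auto simp: coeff_residues_def fun_eq_iff restrict_def)
  then have *: "{\<omega> \<in> space M. coeff_residues d n (F \<omega>) = v} = (\<Inter>k\<in>{..d}. X k -` {v k} \<inter> space M)"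
    by (auto simp: X_def)
  show "{\<omega> \<in> space M. coeff_residues d n (F \<omega>) = v} \<in> events"
    unfolding * using X by (intro sets.finite_INT measurable_sets) (auto simp: indep_vars_def)
  have "prob {\<omega> \<in> space M. coeff_residues d n (F \<omega>) = v} =
      (\<Prod>k\<in>{..d}. prob (X k -` {v k} \<inter> space M))"
    unfolding * by (rule indep_varsD_finite[OF X]) auto
  also have "\<dots> = (\<Prod>k\<in>{..d}. 1 / real CARD('p) ^ n)"
    using prob_residue_coeff v
    by (intro prod.cong) (auto simp: X_def vimage_def Int_def conj_commute)
  finally show "prob {\<omega> \<in> space M. coeff_residues d n (F \<omega>) = v} = (1 / real CARD('p) ^ n) ^ Suc d"
    by simp
qed

text \<open>The residue vector of \<open>F \<omega>\<close> is a measurable map to a finite discrete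
  space, and every function on such a space is measurable.\<close>

lemma measurable_residue_coeff_pcompose:
  "(\<lambda>\<omega>. residue (poly.coeff (pcompose (F \<omega>) q) i) n) \<in> measurable M (count_space UNIV)"
proof -
  define V where "V = {..d} \<rightarrow>\<^sub>E {0..<int CARD('p) ^ n}"
  have "finite V"
    by (simp add: V_def finite_PiE)
  then have "(\<lambda>\<omega>. coeff_residues d n (F \<omega>)) \<in> measurable M (count_space V)"
    using prob_coeff_residues(1)
    by (subst measurable_count_space_eq_countable)
      (auto simp: V_def coeff_residues_in_PiE vimage_def Int_def conj_commute countable_finite)
  then have "(\<lambda>\<omega>. residue (poly.coeff (pcompose (poly_of d (coeff_residues d n (F \<omega>))) q) i) n)
      \<in> measurable M (count_space UNIV)"
    by (rule measurable_compose) simp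
  then show ?thesis
    by (subst measurable_cong) (rule residue_coeff_pcompose_poly_of, rule degree_random_poly)
qed

section \<open>Distribution of the coefficients of f(x + T)\<close>

text \<open>The event is a disjoint union over residue vectors in the product of the
  \<open>B i\<close>. Inverting the shift, each vector has the same probability as a vector of the
  original coefficients, so the shifted coefficients are again independent and uniform modulo
  p^n.\<close>

lemma prob_residue_coeff_shift:
  assumes "\<And>i. i \<le> d \<Longrightarrow> B i \<subseteq> {0..<int CARD('p) ^ n}"
  shows "prob {\<omega> \<in> space M. \<forall>i\<le>d. residue (poly.coeff (pcompose (F \<omega>) [:x, 1:]) i) n \<in> B i} =
    (\<Prod>i\<le>d. real (card (B i)) / real CARD('p) ^ n)"
proof -
  define E where "E w = {\<omega> \<in> space M. coeff_residues d n (pcompose (F \<omega>) [:x, 1:]) = w}" for w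
  define W where "W = Pi\<^sub>E {..d} B"
  have fin: "finite (B i)" if "i \<le> d" for i
    using assms[OF that] finite_subset by blast
  have "coeff_residues d n f \<in> W \<longleftrightarrow> (\<forall>i\<le>d. residue (poly.coeff f i) n \<in> B i)"
    for f :: "'p padic_int poly"
    by (auto simp: W_def coeff_residues_def PiE_iff)
  then have *: "{\<omega> \<in> space M. \<forall>i\<le>d. residue (poly.coeff (pcompose (F \<omega>) [:x, 1:]) i) n \<in> B i} =
      (\<Union>w\<in>W. E w)"
    by (auto simp: E_def)
  have E: "E w \<in> events" "prob (E w) = (1 / real CARD('p) ^ n) ^ Suc d" if "w \<in> W" for w
  proof -
    have "w \<in> {..d} \<rightarrow>\<^sub>E {0..<int CARD('p) ^ n}"
      using that assms unfolding W_def by (meson PiE_mono atMost_iff subsetD)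
    then have "E w = {\<omega> \<in> space M. coeff_residues d n (F \<omega>) =
        coeff_residues d n (pcompose (poly_of d w) [:- x, 1:])}"
      using coeff_residues_pcompose_shift_eq_iff degree_random_poly unfolding E_def by blast
    then show "E w \<in> events" "prob (E w) = (1 / real CARD('p) ^ n) ^ Suc d"
      using prob_coeff_residues[OF coeff_residues_in_PiE] by simp_all
  qed
  have "prob (\<Union>w\<in>W. E w) = (\<Sum>w\<in>W. prob (E w))"
    using E(1) fin
    by (intro finite_measure_finite_Union) (auto simp: W_def E_def disjoint_family_on_def intro!: finite_PiE)
  also have "\<dots> = (\<Prod>i\<le>d. real (card (B i))) * (1 / real CARD('p) ^ n) ^ Suc d"
    using E(2) by (simp add: W_def card_PiE)
  also have "\<dots> = (\<Prod>i\<le>d. real (card (B i)) * (1 / real CARD('p) ^ n))"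
    unfolding prod.distrib prod_constant card_atMost ..
  finally show ?thesis
    unfolding * by simp
qed

text \<open>With q = p^s, the condition at index j has probability q^(-(k - j)), and the conditions
  are independent.\<close>

lemma prob_residue_coeff_shift_eq_0:
  assumes "k \<le> d"
  shows "prob {\<omega> \<in> space M. \<forall>j<k. residue (poly.coeff (pcompose (F \<omega>) [:x, 1:]) j) (s * (k - j)) = 0} =
    (1 / real CARD('p) ^ s) ^ (Suc k choose 2)"
proof -
  define p where "p = int CARD('p)"
  have p: "0 < p" using card_gt_1[where 'p = 'p] by (simp add: p_def)
  have real_p: "real_of_int p = real CARD('p)" by (simp add: p_def)
  \<comment> \<open>All conditions are read off modulo the common power p^(s k). For i < k there
    remain p^(s i) admissible residues; the other indices are unconstrained.\<close>
  define B where "B i = (if i < k then {z \<in> {0..<p ^ (s * k)}. p ^ (s * (k - i)) dvd z}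
    else {0..<p ^ (s * k)})" for i
  have B: "B i \<subseteq> {0..<int CARD('p) ^ (s * k)}" for i
    by (auto simp: B_def p_def)
  have "residue z (s * (k - i)) = 0 \<longleftrightarrow> residue z (s * k) \<in> B i" if "i < k"
    for z :: "'p padic_int" and i
    using that residue_bounds[of z "s * k"] card_power_dvd_residue_iff[of "s * (k - i)" "s * k" z]
    by (simp add: B_def p_def)
  moreover have "residue z (s * k) \<in> B i" if "\<not> i < k" for z :: "'p padic_int" and i
    using that residue_bounds[of z "s * k"] by (simp add: B_def p_def)
  ultimately have "(\<forall>j<k. residue (poly.coeff f j) (s * (k - j)) = 0) \<longleftrightarrow>
      (\<forall>i\<le>d. residue (poly.coeff f i) (s * k) \<in> B i)" for f :: "'p padic_int poly"
    using assms by (meson le_trans less_imp_le_nat linorder_not_less)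
  then have "prob {\<omega> \<in> space M. \<forall>j<k. residue (poly.coeff (pcompose (F \<omega>) [:x, 1:]) j) (s * (k - j)) = 0} =
      (\<Prod>i\<le>d. real (card (B i)) / real CARD('p) ^ (s * k))"
    using prob_residue_coeff_shift[of B "s * k" x, OF B] by simp
  also have "\<dots> = (\<Prod>i\<in>{..d}. if i < k then (1 / real CARD('p) ^ s) ^ (k - i) else 1)"
  proof (intro prod.cong refl)
    fix i
    show "real (card (B i)) / real CARD('p) ^ (s * k) =
      (if i < k then (1 / real CARD('p) ^ s) ^ (k - i) else 1)"
    proof (cases "i < k")
      case True
      then have sk: "s * k = s * (k - i) + s * i"
        by (simp flip: distrib_left)
      have "card (B i) = nat (p ^ (s * i))"
        using True p card_multiples_below[of "p ^ (s * (k - i))" "p ^ (s * i)"]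
        unfolding B_def sk power_add by simp
      then have "real (card (B i)) = real CARD('p) ^ (s * i)"
        using p by (simp add: real_p)
      with True p real_p show ?thesis
        unfolding sk power_add by (simp add: power_mult power_one_over)
    qed (use p in \<open>simp add: B_def real_p\<close>)
  qed
  also have "\<dots> = (\<Prod>i<k. (1 / real CARD('p) ^ s) ^ (k - i))"
    using assms by (intro prod.mono_neutral_cong_right) auto
  also have "\<dots> = (1 / real CARD('p) ^ s) ^ (Suc k choose 2)"
    by (rule prod_power_diff)
  finally show ?thesis .
qed

text \<open>Needed because the Strassman number of the zero polynomial is an unspecified value.\<close>

lemma AE_random_poly_nonzero: "AE \<omega> in M. F \<omega> \<noteq> 0"
proof -
  define Z where "Z n = {\<omega> \<in> space M. residue (poly.coeff (F \<omega>) 0) n = 0}" for n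
  have [measurable]: "(\<lambda>\<omega>. poly.coeff (F \<omega>) 0) \<in> borel_measurable M"
    by (simp add: measurable_coeff)
  have Z [measurable]: "Z n \<in> events" for n
    unfolding Z_def by measurable
  have "prob (\<Inter>n. Z n) \<le> (1 / real CARD('p)) ^ n" for n
  proof -
    have "prob (\<Inter>n. Z n) \<le> prob (Z n)"
      by (intro finite_measure_mono) auto
    also have "\<dots> = (1 / real CARD('p)) ^ n"
      unfolding Z_def by (subst prob_residue_coeff) (simp_all add: power_one_over)
    finally show ?thesis .
  qed
  moreover have "(\<lambda>n. (1 / real CARD('p)) ^ n) \<longlonglongrightarrow> 0"
    using card_gt_1[where 'p = 'p] by (intro LIMSEQ_realpow_zero) auto
  ultimately have "prob (\<Inter>n. Z n) \<le> 0"
    by (intro LIMSEQ_le_const) auto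
  then have "(\<Inter>n. Z n) \<in> null_sets M"
    by (simp add: null_sets_def emeasure_eq_measure antisym[OF _ measure_nonneg])
  then show ?thesis
    by (rule AE_I') (auto simp: Z_def zero_padic_int.rep_eq)
qed

section \<open>The Strassman number as a random variable: tail and moments\<close>

lemma measurable_strassman_at:
  "(\<lambda>\<omega>. strassman_at (fract_poly (F \<omega>)) (to_fract x) s) \<in> measurable M (count_space UNIV)"
proof -
  note measurable_residue_coeff_pcompose [measurable]
  show ?thesis
    unfolding strassman_at_fract_poly padic_int_abs_le_iff by measurable
qed

lemma AE_strassman_at:
  "AE \<omega> in M. strassman_at (fract_poly (F \<omega>)) (to_fract x) s \<le> d \<and>
    (\<forall>j<strassman_at (fract_poly (F \<omega>)) (to_fract x) s.
      residue (poly.coeff (pcompose (F \<omega>) [:x, 1:]) j)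
        (s * (strassman_at (fract_poly (F \<omega>)) (to_fract x) s - j)) = 0)"
  using AE_random_poly_nonzero AE_space
proof eventually_elim
  fix \<omega>
  assume "F \<omega> \<noteq> 0" "\<omega> \<in> space M"
  note properties = strassman_at_properties[OF this(1) degree_random_poly[OF this(2)] refl]
  show "strassman_at (fract_poly (F \<omega>)) (to_fract x) s \<le> d \<and>
    (\<forall>j<strassman_at (fract_poly (F \<omega>)) (to_fract x) s.
      residue (poly.coeff (pcompose (F \<omega>) [:x, 1:]) j)
        (s * (strassman_at (fract_poly (F \<omega>)) (to_fract x) s - j)) = 0)"
    by (intro conjI allI impI properties)
qed

text \<open>Union bound over the possible values k from \<open>l\<close> to \<open>d\<close> of the
  Strassman number. The case \<open>l = 0\<close> is separate because the comparison with a series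
  of ratio 1/4 starts at 1; there the right-hand side is 4/3.\<close>

lemma prob_strassman_at_ge:
  assumes "1 \<le> s"
  shows "prob {\<omega> \<in> space M. l \<le> strassman_at (fract_poly (F \<omega>)) (to_fract x) s} \<le>
    4 / 3 * (1 / real CARD('p) ^ s) ^ (Suc l choose 2)"
proof (cases "l = 0")
  case True
  have "prob {\<omega> \<in> space M. l \<le> strassman_at (fract_poly (F \<omega>)) (to_fract x) s} \<le> 1"
    by simp
  with True show ?thesis
    by (simp add: numeral_2_eq_2 del: prob_le_1)
next
  case False
  define r where "r = 1 / real CARD('p) ^ s"
  have r: "0 \<le> r" "r \<le> 1 / 2"
    using two_le_card_power[OF assms, where 'p = 'p] by (simp_all add: r_def field_simps)
  define E where "E k = {\<omega> \<in> space M. \<forall>j<k.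
    residue (poly.coeff (pcompose (F \<omega>) [:x, 1:]) j) (s * (k - j)) = 0}" for k
  note measurable_residue_coeff_pcompose [measurable]
  have E: "E k \<in> events" for k
    unfolding E_def by measurable
  have "prob {\<omega> \<in> space M. l \<le> strassman_at (fract_poly (F \<omega>)) (to_fract x) s} \<le>
      prob (\<Union>k\<in>{l..d}. E k)"
  proof (rule finite_measure_mono_AE)
    show "AE \<omega> in M. \<omega> \<in> {\<omega> \<in> space M. l \<le> strassman_at (fract_poly (F \<omega>)) (to_fract x) s} \<longrightarrow>
        \<omega> \<in> (\<Union>k\<in>{l..d}. E k)"
      using AE_strassman_at[of x s] by eventually_elim (unfold E_def, blast intro: atLeastAtMost_iff[THEN iffD2])
  qed (use E in auto)
  also have "\<dots> \<le> (\<Sum>k\<in>{l..d}. prob (E k))"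
    by (rule finite_measure_subadditive_finite) (use E in auto)
  also have "\<dots> = (\<Sum>k\<in>{l..d}. r ^ (Suc k choose 2))"
    unfolding E_def r_def by (intro sum.cong refl prob_residue_coeff_shift_eq_0) simp
  \<comment> \<open>Enlarges the range to one of prescribed length starting at \<open>l\<close>, the
    shape required by \<open>sum_power_choose_2_le\<close>.\<close>
  also have "\<dots> \<le> (\<Sum>k=l..<l + Suc d. r ^ (Suc k choose 2))"
    by (rule sum_mono2) (use r in auto)
  also have "\<dots> \<le> 4 / 3 * r ^ (Suc l choose 2)"
    by (rule sum_power_choose_2_le) (use r False in auto)
  finally show ?thesis
    by (simp add: r_def)
qed

text \<open>Almost surely S^k is dominated by the sum of l^k times the indicator of
  \<open>E l\<close>: the term \<open>l = S \<omega>\<close> is present and the others are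
  nonnegative. Integrating this sum uses the exact probabilities of the events instead of the tail
  bound.\<close>

lemma strassman_at_moment:
  assumes "1 \<le> s" "0 < k"
  shows "integrable M (\<lambda>\<omega>. real (strassman_at (fract_poly (F \<omega>)) (to_fract x) s) powr k)"
    and "(LINT \<omega>|M. real (strassman_at (fract_poly (F \<omega>)) (to_fract x) s) powr k) \<le>
      2 * (1 / real CARD('p) ^ s) * (1 + (k / ln (real CARD('p) ^ s)) powr (k / 2))"
proof -
  define S where "S \<omega> = strassman_at (fract_poly (F \<omega>)) (to_fract x) s" for \<omega>
  define E where "E l = {\<omega> \<in> space M. \<forall>j<l.
    residue (poly.coeff (pcompose (F \<omega>) [:x, 1:]) j) (s * (l - j)) = 0}" for l
  define g where "g \<omega> = (\<Sum>l=1..d. real l powr k * indicator (E l) \<omega>)" for \<omega>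
  note measurable_residue_coeff_pcompose [measurable]
  have S [measurable]: "S \<in> measurable M (count_space UNIV)"
    using measurable_strassman_at[of x s] by (simp add: S_def[abs_def])
  have E [measurable]: "E l \<in> events" for l
    unfolding E_def by measurable
  have le: "AE \<omega> in M. real (S \<omega>) powr k \<le> g \<omega>"
    using AE_strassman_at[of x s] AE_space
  proof eventually_elim
    fix \<omega>
    assume "strassman_at (fract_poly (F \<omega>)) (to_fract x) s \<le> d \<and>
      (\<forall>j<strassman_at (fract_poly (F \<omega>)) (to_fract x) s.
        residue (poly.coeff (pcompose (F \<omega>) [:x, 1:]) j)
          (s * (strassman_at (fract_poly (F \<omega>)) (to_fract x) s - j)) = 0)" "\<omega> \<in> space M"
    then have "S \<omega> \<le> d" "\<omega> \<in> E (S \<omega>)"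
      by (simp_all add: S_def E_def)
    show "real (S \<omega>) powr k \<le> g \<omega>"
    proof (cases "S \<omega> = 0")
      \<comment> \<open>The left-hand side vanishes, since \<open>0 powr k = 0\<close>.\<close>
      case True
      then show ?thesis by (simp add: g_def sum_nonneg)
    next
      case False
      with \<open>S \<omega> \<le> d\<close> have "real (S \<omega>) powr k * indicator (E (S \<omega>)) \<omega> \<le> g \<omega>"
        unfolding g_def by (intro member_le_sum) auto
      with \<open>\<omega> \<in> E (S \<omega>)\<close> show ?thesis by simp
    qed
  qed
  have g: "integrable M g"
    unfolding g_def
    by (intro Bochner_Integration.integrable_sum integrable_mult_right integrable_real_indicator E)
      (simp add: less_top[symmetric])
  have int: "integrable M (\<lambda>\<omega>. real (S \<omega>) powr k)"
  proof (rule Bochner_Integration.integrable_bound[OF g])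
    show "AE \<omega> in M. norm (real (S \<omega>) powr k) \<le> norm (g \<omega>)"
      using le by eventually_elim simp
  qed simp
  then show "integrable M (\<lambda>\<omega>. real (strassman_at (fract_poly (F \<omega>)) (to_fract x) s) powr k)"
    by (simp add: S_def)
  have "(LINT \<omega>|M. real (S \<omega>) powr k) \<le> (LINT \<omega>|M. g \<omega>)"
    using int g le by (rule integral_mono_AE)
  also have "\<dots> = (\<Sum>l=1..d. real l powr k * prob (E l))"
  proof -
    have "integrable M (\<lambda>\<omega>. real l powr k * indicator (E l) \<omega>)" for l
      by (intro integrable_mult_right integrable_real_indicator E) (simp add: less_top[symmetric])
    then have "(LINT \<omega>|M. g \<omega>) = (\<Sum>l=1..d. LINT \<omega>|M. real l powr k * indicator (E l) \<omega>)"
      unfolding g_def by (intro Bochner_Integration.integral_sum)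
    then show ?thesis
      unfolding integral_mult_right_zero Bochner_Integration.integral_indicator
        sets.Int_space_eq2[OF E] .
  qed
  also have "\<dots> = (\<Sum>l=1..d. real l powr k * (1 / real CARD('p) ^ s) ^ (Suc l choose 2))"
    unfolding E_def by (intro sum.cong refl arg_cong[where f = "\<lambda>y. _ * y"] prob_residue_coeff_shift_eq_0) simp
  also have "\<dots> \<le> 2 * (1 / real CARD('p) ^ s) * (1 + (k / ln (real CARD('p) ^ s)) powr (k / 2))"
    using assms(2) two_le_card_power[OF assms(1)] by (rule sum_powr_mult_power_choose_2_le)
  finally show "(LINT \<omega>|M. real (strassman_at (fract_poly (F \<omega>)) (to_fract x) s) powr k) \<le>
      2 * (1 / real CARD('p) ^ s) * (1 + (k / ln (real CARD('p) ^ s)) powr (k / 2))"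
    by (simp add: S_def)
qed

end

theorem theorem4p10:
  fixes M :: "'w measure"
    and F :: "'w \<Rightarrow> 'p :: prime_card padic_int poly"
    and x :: "'p padic_int"
    and d s :: nat
  assumes "random_padic_poly M d F"
    and "s \<ge> 1"
  shows "(\<lambda>\<omega>. strassman_at (fract_poly (F \<omega>)) (to_fract x) s) \<in> measurable M (count_space UNIV) \<and>
    (\<forall>l :: nat. measure M {\<omega> \<in> space M. strassman_at (fract_poly (F \<omega>)) (to_fract x) s \<ge> l}
      \<le> 4 / 3 * real CARD('p) powr (- real (s * ((l + 1) choose 2)))) \<and>
    (\<forall>k :: real. k \<ge> 1 \<longrightarrow>
      integrable M (\<lambda>\<omega>. real (strassman_at (fract_poly (F \<omega>)) (to_fract x) s) powr k) \<and>
      (LINT \<omega>|M. real (strassman_at (fract_poly (F \<omega>)) (to_fract x) s) powr k)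
        \<le> 2 * real CARD('p) powr (- real s) *
          (1 + (k / (real s * ln (real CARD('p)))) powr (k / 2)))"
proof -
  have p: "0 < real CARD('p)"
    by (rule of_nat_0_less_iff[THEN iffD2, OF prime_gt_0_nat[OF prime_card]])
  have powr: "real CARD('p) powr (- real (s * m)) = (1 / real CARD('p) ^ s) ^ m" for m
  proof -
    have "real CARD('p) powr (- real (s * m)) = inverse (real CARD('p) ^ (s * m))"
      unfolding powr_minus powr_realpow[OF p] ..
    also have "\<dots> = (1 / real CARD('p) ^ s) ^ m"
      unfolding power_mult inverse_eq_divide power_one_over ..
    finally show ?thesis .
  qed
  have powr': "real CARD('p) powr (- real s) = 1 / real CARD('p) ^ s"
    using powr[of 1] unfolding mult_1_right power_one_right .
  \<comment> \<open>Together with the two preceding identities this rewrites both bounds in terms of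
    q = p^s.\<close>
  have ln: "real s * ln (real CARD('p)) = ln (real CARD('p) ^ s)"
    using p by (simp add: ln_realpow)
  show ?thesis
  proof (intro conjI allI impI)
    fix l :: nat
    show "measure M {\<omega> \<in> space M. strassman_at (fract_poly (F \<omega>)) (to_fract x) s \<ge> l}
        \<le> 4 / 3 * real CARD('p) powr (- real (s * ((l + 1) choose 2)))"
      using prob_strassman_at_ge[OF assms] by (simp only: powr Suc_eq_plus1)
  next
    fix k :: real
    assume "1 \<le> k"
    then have k: "0 < k" by simp
    show "integrable M (\<lambda>\<omega>. real (strassman_at (fract_poly (F \<omega>)) (to_fract x) s) powr k)"
      using assms k by (rule strassman_at_moment)
    show "(LINT \<omega>|M. real (strassman_at (fract_poly (F \<omega>)) (to_fract x) s) powr k)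
        \<le> 2 * real CARD('p) powr (- real s) *
          (1 + (k / (real s * ln (real CARD('p)))) powr (k / 2))"
      unfolding powr' ln using assms k by (rule strassman_at_moment)
  qed (rule measurable_strassman_at[OF assms(1)])
qed

end
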